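(* Let $n\geq 4$, let $\langle A\mid R\rangle$ be any monoid presentation for the symmetric group $S_n$, and let $\langle A,\eta\mid R,S\rangle$ be a monoid presentation for the symmetric inverse monoid $I_n$, where $\eta$ represents the idempotent of rank $n-1$ in $I_n$ with $1\notin\operatorname{dom}(\eta)$. Then there is at least one relation of rank $n-2$ in $S$.
   Context: Maps act on the right and are composed from left to right. $I_n$ is the monoid of all injective partial maps from $\{1,\ldots,n\}$ to itself; its group of units is $S_n$; the rank of an element is the size of its image. A monoid presentation $\langle X\mid Q\rangle$ with $Q\subseteq X^*\times X^*$ defines the quotient of the free monoid $X^*$ by the least congruence $Q^{\sharp}$ containing $Q$; $\langle A,\eta\mid R,S\rangle$ means $\langle A\cup\{\eta\}\mid R\cup S\rangle$, with $\eta\notin A$. The letters of $A$ represent permutations in $S_n$, and $\phi:(A\cup\{\eta\})^*\to I_n$ denotes the surjective homomorphism sending each letter to the element it represents; its kernel is the congruence generated by $R\cup S$, and its restriction to $A^*$ has image $S_n$ and kernel the congruence on $A^*$ generated by $R$. A word $w$ has rank $r$ if $(w)\phi$ has rank $r$; a relation $(u,v)$ has rank $r$ if $u$ (equivalently $v$) has rank $r$. *)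

theory Defs
  imports "HOL-Algebra.Group"
begin

section \<open>Monoid presentations\<close>

definition word_congruence :: "'a set \<Rightarrow> ('a list \<times> 'a list) set \<Rightarrow> bool" where
  "word_congruence X E \<longleftrightarrow> equiv (lists X) E \<and>
     (\<forall>(u, v) \<in> E. \<forall>w \<in> lists X. (w @ u, w @ v) \<in> E \<and> (u @ w, v @ w) \<in> E)"

text \<open>For \<open>Q \<subseteq> lists X \<times> lists X\<close> this is the least congruence on the free monoid over \<open>X\<close>
  that contains \<open>Q\<close>: the family is nonempty, since it contains \<open>lists X \<times> lists X\<close>.\<close>

definition generated_congruence ::
    "'a set \<Rightarrow> ('a list \<times> 'a list) set \<Rightarrow> ('a list \<times> 'a list) set" where
  "generated_congruence X Q = \<Inter>{E. word_congruence X E \<and> Q \<subseteq> E}"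

definition word_value :: "('m, 'b) monoid_scheme \<Rightarrow> ('a \<Rightarrow> 'm) \<Rightarrow> 'a list \<Rightarrow> 'm" where
  "word_value M \<rho> w = foldr (\<lambda>x m. \<rho> x \<otimes>\<^bsub>M\<^esub> m) w \<one>\<^bsub>M\<^esub>"

definition word_kernel ::
    "'a set \<Rightarrow> ('m, 'b) monoid_scheme \<Rightarrow> ('a \<Rightarrow> 'm) \<Rightarrow> ('a list \<times> 'a list) set" where
  "word_kernel X M \<rho> =
     {(u, v). u \<in> lists X \<and> v \<in> lists X \<and> word_value M \<rho> u = word_value M \<rho> v}"

text \<open>\<open>X\<close> and \<open>Q\<close> present the monoid \<open>M\<close>, the letter \<open>x\<close> representing \<open>\<rho> x\<close>. Neither \<open>X\<close> nor
  \<open>Q\<close> needs to be finite, and different letters may represent the same element.\<close>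

definition monoid_presentation ::
    "'a set \<Rightarrow> ('a list \<times> 'a list) set \<Rightarrow> ('m, 'b) monoid_scheme \<Rightarrow> ('a \<Rightarrow> 'm) \<Rightarrow> bool" where
  "monoid_presentation X Q M \<rho> \<longleftrightarrow>
     Q \<subseteq> lists X \<times> lists X \<and>
     \<rho> \<in> X \<rightarrow> carrier M \<and>
     word_value M \<rho> ` lists X = carrier M \<and>
     word_kernel X M \<rho> = generated_congruence X Q"

section \<open>The symmetric inverse monoid\<close>

text \<open>Maps act on the right, so the product of \<open>f\<close> and \<open>g\<close> is \<open>f\<close> followed by \<open>g\<close>.\<close>

definition sym_inv_monoid :: "nat \<Rightarrow> (nat \<rightharpoonup> nat) monoid" where
  "sym_inv_monoid n =
     \<lparr>carrier = {f. dom f \<subseteq> {1..n} \<and> ran f \<subseteq> {1..n} \<and> inj_on f (dom f)},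
      mult = (\<lambda>f g. g \<circ>\<^sub>m f),
      one = Some |` {1..n}\<rparr>"

definition symmetric_group :: "nat \<Rightarrow> (nat \<rightharpoonup> nat) monoid" where
  "symmetric_group n = units_of (sym_inv_monoid n)"

definition map_rank :: "(nat \<rightharpoonup> nat) \<Rightarrow> nat" where
  "map_rank f = card (ran f)"

definition word_rank :: "nat \<Rightarrow> ('a \<Rightarrow> nat \<rightharpoonup> nat) \<Rightarrow> 'a list \<Rightarrow> nat" where
  "word_rank n \<rho> w = map_rank (word_value (sym_inv_monoid n) \<rho> w)"

text \<open>Only the left-hand side is used; by \<open>word_rank_relation_sides\<close> below, both sides of a
  defining relation have the same rank.\<close>

definition relation_rank :: "nat \<Rightarrow> ('a \<Rightarrow> nat \<rightharpoonup> nat) \<Rightarrow> 'a list \<times> 'a list \<Rightarrow> nat" where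
  "relation_rank n \<rho> r = word_rank n \<rho> (fst r)"

lemma word_rank_relation_sides:
  assumes "monoid_presentation X Q (sym_inv_monoid n) \<rho>" and "(u, v) \<in> Q"
  shows "word_rank n \<rho> u = word_rank n \<rho> v"
proof -
  have "(u, v) \<in> generated_congruence X Q"
    using assms(2) by (auto simp: generated_congruence_def)
  then have "(u, v) \<in> word_kernel X (sym_inv_monoid n) \<rho>"
    using assms(1) by (simp add: monoid_presentation_def)
  then show ?thesis
    by (simp add: word_kernel_def word_rank_def)
qed

lemma monoid_sym_inv_monoid: "monoid (sym_inv_monoid n)"
proof (rule monoidI)
  fix f g assume f: "f \<in> carrier (sym_inv_monoid n)" and g: "g \<in> carrier (sym_inv_monoid n)"
  have "inj_on (g \<circ>\<^sub>m f) (dom (g \<circ>\<^sub>m f))"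
  proof (rule inj_onI)
    fix x y
    assume x: "x \<in> dom (g \<circ>\<^sub>m f)" and y: "y \<in> dom (g \<circ>\<^sub>m f)"
      and eq: "(g \<circ>\<^sub>m f) x = (g \<circ>\<^sub>m f) y"
    from x obtain a c where a: "f x = Some a" "g a = Some c"
      by (auto simp: map_comp_Some_iff)
    from y obtain b d where b: "f y = Some b" "g b = Some d"
      by (auto simp: map_comp_Some_iff)
    have "g a = g b" using eq a b by (simp add: map_comp_def)
    with a b g have "a = b"
      by (simp add: sym_inv_monoid_def) (metis domI inj_onD)
    with a b f show "x = y"
      by (simp add: sym_inv_monoid_def) (metis domI inj_onD)
  qed
  with f g show "f \<otimes>\<^bsub>sym_inv_monoid n\<^esub> g \<in> carrier (sym_inv_monoid n)"
    by (auto simp: sym_inv_monoid_def map_comp_Some_iff ran_def dom_def)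
next
  show "\<one>\<^bsub>sym_inv_monoid n\<^esub> \<in> carrier (sym_inv_monoid n)"
    by (auto simp: sym_inv_monoid_def inj_on_def restrict_map_def ran_def split: if_splits)
next
  fix f g h :: "nat \<rightharpoonup> nat"
  show "f \<otimes>\<^bsub>sym_inv_monoid n\<^esub> g \<otimes>\<^bsub>sym_inv_monoid n\<^esub> h =
        f \<otimes>\<^bsub>sym_inv_monoid n\<^esub> (g \<otimes>\<^bsub>sym_inv_monoid n\<^esub> h)"
    by (auto simp: sym_inv_monoid_def map_comp_def fun_eq_iff split: option.splits)
next
  fix f assume f: "f \<in> carrier (sym_inv_monoid n)"
  show "\<one>\<^bsub>sym_inv_monoid n\<^esub> \<otimes>\<^bsub>sym_inv_monoid n\<^esub> f = f"
  proof (rule ext)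
    fix x
    have "f x = None" if "x \<notin> {1..n}"
      using f that by (auto simp: sym_inv_monoid_def dom_def)
    then show "(\<one>\<^bsub>sym_inv_monoid n\<^esub> \<otimes>\<^bsub>sym_inv_monoid n\<^esub> f) x = f x"
      by (auto simp: sym_inv_monoid_def map_comp_def restrict_map_def)
  qed
  show "f \<otimes>\<^bsub>sym_inv_monoid n\<^esub> \<one>\<^bsub>sym_inv_monoid n\<^esub> = f"
  proof (rule ext)
    fix x
    have "y \<in> {1..n}" if "f x = Some y" for y
      using f that by (auto simp: sym_inv_monoid_def ran_def)
    then show "(f \<otimes>\<^bsub>sym_inv_monoid n\<^esub> \<one>\<^bsub>sym_inv_monoid n\<^esub>) x = f x"
      by (auto simp: sym_inv_monoid_def map_comp_def restrict_map_def split: option.splits)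
  qed
qed

text \<open>The units are exactly the permutations, viewed as total injective maps.\<close>

lemma carrier_symmetric_group:
  "carrier (symmetric_group n) = {f \<in> carrier (sym_inv_monoid n). dom f = {1..n}}"
proof (intro Set.set_eqI iffI)
  fix f assume "f \<in> carrier (symmetric_group n)"
  then obtain g where f: "f \<in> carrier (sym_inv_monoid n)" and "g \<circ>\<^sub>m f = Some |` {1..n}"
    by (auto simp: symmetric_group_def units_of_def Units_def sym_inv_monoid_def)
  then have "dom (g \<circ>\<^sub>m f) = {1..n}" by simp
  moreover have "dom (g \<circ>\<^sub>m f) \<subseteq> dom f" by (auto simp: map_comp_Some_iff)
  ultimately show "f \<in> {f \<in> carrier (sym_inv_monoid n). dom f = {1..n}}"
    using f by (auto simp: sym_inv_monoid_def)
next
  fix f assume "f \<in> {f \<in> carrier (sym_inv_monoid n). dom f = {1..n}}"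
  then have f: "dom f = {1..n}" "ran f \<subseteq> {1..n}" "inj_on f (dom f)"
    by (auto simp: sym_inv_monoid_def)
  define p where "p = (\<lambda>x. the (f x))"
  have fp: "f x = (if x \<in> {1..n} then Some (p x) else None)" for x
  proof (cases "f x")
    case None
    then have "x \<notin> dom f" by (simp add: domIff)
    then have "x \<notin> {1..n}" by (simp only: f(1) not_False_eq_True)
    with None show ?thesis by simp
  next
    case (Some y)
    then have "x \<in> dom f" by (simp add: domI)
    then have "x \<in> {1..n}" by (simp only: f(1))
    with Some show ?thesis by (simp add: p_def)
  qed
  have inj: "inj_on p {1..n}"
  proof (rule inj_onI)
    fix x y assume x: "x \<in> {1..n}" and y: "y \<in> {1..n}" and "p x = p y"
    then have "f x = f y" by (simp add: fp)
    with f(3) x y show "x = y" unfolding f(1) by (blast dest: inj_onD)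
  qed
  have "p ` {1..n} \<subseteq> {1..n}"
  proof (rule image_subsetI)
    fix x assume "x \<in> {1..n}"
    then have "f x = Some (p x)" by (simp add: fp)
    with f(2) show "p x \<in> {1..n}" by (blast intro: ranI)
  qed
  then have img: "p ` {1..n} = {1..n}"
    using inj by (intro endo_inj_surj) simp_all
  define q where "q = inv_into {1..n} p"
  define g where "g = (\<lambda>y. if y \<in> {1..n} then Some (q y) else None)"
  have q: "q y \<in> {1..n}" "p (q y) = y" if "y \<in> {1..n}" for y
    using that img unfolding q_def by (simp_all add: inv_into_into f_inv_into_f del: atLeastAtMost_iff)
  have qp: "q (p x) = x" if "x \<in> {1..n}" for x
    using that inj unfolding q_def by simp
  have pin: "p x \<in> {1..n}" if "x \<in> {1..n}" for x
    using that img by blast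
  have dom_g: "dom g = {1..n}"
    by (auto simp: g_def dom_def)
  have ran_g: "ran g \<subseteq> {1..n}"
  proof
    fix z assume "z \<in> ran g"
    then obtain y where "g y = Some z" by (auto simp: ran_def)
    then have "y \<in> {1..n}" "z = q y" by (simp_all add: g_def split: if_splits)
    then show "z \<in> {1..n}" using q(1) by simp
  qed
  have inj_g: "inj_on g (dom g)"
    unfolding dom_g
  proof (rule inj_onI)
    fix x y assume x: "x \<in> {1..n}" and y: "y \<in> {1..n}" and "g x = g y"
    then have "q x = q y" by (simp add: g_def)
    then have "p (q x) = p (q y)" by simp
    then show "x = y" by (simp only: q(2)[OF x] q(2)[OF y])
  qed
  have "g \<in> carrier (sym_inv_monoid n)"
    using dom_g ran_g inj_g by (simp add: sym_inv_monoid_def)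
  moreover have "g \<circ>\<^sub>m f = Some |` {1..n}"
  proof (rule ext)
    fix x show "(g \<circ>\<^sub>m f) x = (Some |` {1..n}) x"
      using pin[of x] qp[of x] by (cases "x \<in> {1..n}") (simp_all add: fp g_def)
  qed
  moreover have "f \<circ>\<^sub>m g = Some |` {1..n}"
  proof (rule ext)
    fix x show "(f \<circ>\<^sub>m g) x = (Some |` {1..n}) x"
      using q[of x] by (cases "x \<in> {1..n}") (simp_all add: fp[of "q x"] g_def)
  qed
  moreover have "f \<in> carrier (sym_inv_monoid n)"
    using f by (simp add: sym_inv_monoid_def)
  ultimately show "f \<in> carrier (symmetric_group n)"
    unfolding symmetric_group_def units_of_def Units_def
    by (simp add: sym_inv_monoid_def) blast
qed

end

theory Submission
  imports Defs "HOL-Combinatorics.Transposition"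
begin

text \<open>Erasing every \<open>\<eta>\<close> from a word \<open>w\<close> leaves a word that represents a permutation \<open>\<pi>(w)\<close>
  extending the partial map represented by \<open>w\<close>. A partial map of rank at least \<open>n - 1\<close> has at most
  one such extension, so the two sides of a relation of rank at least \<open>n - 1\<close> have the same \<open>\<pi>\<close>.
  Words of rank \<open>n - 2\<close> contain no subword of smaller rank, so in the absence of relations of rank
  \<open>n - 2\<close> the permutation \<open>\<pi>\<close> would be an invariant of the words of rank \<open>n - 2\<close>.
  But if \<open>t\<close> represents the transposition \<open>(1 2)\<close>, then \<open>\<eta> t \<eta>\<close> and \<open>\<eta> t \<eta> t\<close> both
  represent the identity on \<open>{3..n}\<close>, while \<open>\<pi>\<close> takes different values on them.\<close>

section \<open>Values of words and generated congruences\<close>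

lemma word_value_Nil [simp]: "word_value M \<rho> [] = \<one>\<^bsub>M\<^esub>"
  by (simp add: word_value_def)

lemma word_value_Cons [simp]: "word_value M \<rho> (x # w) = \<rho> x \<otimes>\<^bsub>M\<^esub> word_value M \<rho> w"
  by (simp add: word_value_def)

lemma word_value_closed:
  assumes "monoid M" and "\<rho> \<in> X \<rightarrow> carrier M" and "w \<in> lists X"
  shows "word_value M \<rho> w \<in> carrier M"
  using assms(3)
proof induction
  case Nil
  show ?case by (simp add: monoid.one_closed[OF assms(1)])
next
  case (Cons x w)
  then show ?case using assms(2) by (auto intro: monoid.m_closed[OF assms(1)])
qed

lemma word_value_append:
  assumes "monoid M" and "\<rho> \<in> X \<rightarrow> carrier M" and "u \<in> lists X" and "v \<in> lists X"
  shows "word_value M \<rho> (u @ v) = word_value M \<rho> u \<otimes>\<^bsub>M\<^esub> word_value M \<rho> v"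
  using assms(3)
proof induction
  case Nil
  show ?case
    using word_value_closed[OF assms(1,2,4)] by (simp add: monoid.l_one[OF assms(1)])
next
  case (Cons x u)
  have "\<rho> x \<in> carrier M" using Cons(1) assms(2) by auto
  with Cons show ?case
    by (simp add: monoid.m_assoc[OF assms(1)] word_value_closed[OF assms(1,2)] assms(4))
qed

lemma generated_congruence_least:
  "word_congruence X E \<Longrightarrow> Q \<subseteq> E \<Longrightarrow> generated_congruence X Q \<subseteq> E"
  by (auto simp: generated_congruence_def)

lemma generated_congruence_superset: "Q \<subseteq> generated_congruence X Q"
  by (auto simp: generated_congruence_def)

section \<open>Partial injections: rank, extension and idempotents\<close>

lemma word_value_symmetric_group:
  "word_value (symmetric_group n) = word_value (sym_inv_monoid n)"
  by (simp add: word_value_def fun_eq_iff symmetric_group_def units_of_def)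

lemma monoid_symmetric_group: "monoid (symmetric_group n)"
  unfolding symmetric_group_def
  by (intro group.is_monoid monoid.units_group monoid_sym_inv_monoid)

lemma mult_sym_inv_monoid: "f \<otimes>\<^bsub>sym_inv_monoid n\<^esub> g = g \<circ>\<^sub>m f"
  by (simp add: sym_inv_monoid_def)

lemma map_rank_eq_card_dom:
  assumes "f \<in> carrier (sym_inv_monoid n)"
  shows "map_rank f = card (dom f)"
proof -
  \<comment> \<open>The values of \<open>f\<close> are options, so the image of its domain as a set
    is the range wrapped in \<open>Some\<close>; wrapping does not change the cardinality.\<close>
  have "card (Some ` ran f) = card (f ` dom f)"
    by (rule arg_cong[of _ _ card]) (auto simp: ran_def image_iff dom_def, metis)
  then show ?thesis
    using assms by (simp add: map_rank_def card_image sym_inv_monoid_def)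
qed

text \<open>The domain of a product lies in that of the left factor and its range in that of the
  right factor. Hence extending a word on either side never raises its rank.\<close>

lemma map_rank_mult_le:
  assumes f: "f \<in> carrier (sym_inv_monoid n)" and g: "g \<in> carrier (sym_inv_monoid n)"
  shows "map_rank (f \<otimes>\<^bsub>sym_inv_monoid n\<^esub> g) \<le> map_rank f"
    and "map_rank (f \<otimes>\<^bsub>sym_inv_monoid n\<^esub> g) \<le> map_rank g"
proof -
  have "finite (dom f)" and "finite (ran g)"
    using f g by (auto simp: sym_inv_monoid_def intro: finite_subset)
  moreover have "dom (g \<circ>\<^sub>m f) \<subseteq> dom f"
    by (auto simp: map_comp_Some_iff)
  moreover have "ran (g \<circ>\<^sub>m f) \<subseteq> ran g"
    by (auto simp: map_comp_Some_iff ran_def)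
  moreover have "g \<circ>\<^sub>m f \<in> carrier (sym_inv_monoid n)"
    using monoid.m_closed[OF monoid_sym_inv_monoid f g] by (simp add: mult_sym_inv_monoid)
  ultimately have "card (dom (g \<circ>\<^sub>m f)) \<le> card (dom f)"
    and "card (ran (g \<circ>\<^sub>m f)) \<le> card (ran g)"
    and "map_rank (g \<circ>\<^sub>m f) = card (dom (g \<circ>\<^sub>m f))"
    by (simp_all add: card_mono map_rank_eq_card_dom)
  then show "map_rank (f \<otimes>\<^bsub>sym_inv_monoid n\<^esub> g) \<le> map_rank f"
    and "map_rank (f \<otimes>\<^bsub>sym_inv_monoid n\<^esub> g) \<le> map_rank g"
    by (simp_all add: mult_sym_inv_monoid map_rank_eq_card_dom[OF f])
       (simp add: map_rank_def)
qed

lemma map_comp_mono: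
  assumes "f \<subseteq>\<^sub>m f'" and "g \<subseteq>\<^sub>m g'"
  shows "g \<circ>\<^sub>m f \<subseteq>\<^sub>m g' \<circ>\<^sub>m f'"
proof (unfold map_le_def, rule ballI)
  fix x assume "x \<in> dom (g \<circ>\<^sub>m f)"
  then obtain y z where "f x = Some y" "g y = Some z"
    by (auto simp: map_comp_Some_iff)
  moreover from this have "f' x = Some y" "g' y = Some z"
    using assms by (metis domI map_le_def)+
  ultimately show "(g \<circ>\<^sub>m f) x = (g' \<circ>\<^sub>m f') x"
    by simp
qed

text \<open>This makes \<pi>(w) an extension of the map represented by \<open>w\<close>: replacing
  \<eta> by the identity enlarges one letter and hence every product.\<close>

lemma word_value_sym_inv_monoid_mono:
  assumes "\<And>x. x \<in> set w \<Longrightarrow> \<rho> x \<subseteq>\<^sub>m \<rho>' x"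
  shows "word_value (sym_inv_monoid n) \<rho> w \<subseteq>\<^sub>m word_value (sym_inv_monoid n) \<rho>' w"
  using assms by (induction w) (simp_all add: mult_sym_inv_monoid map_comp_mono)

text \<open>At most one point of \<open>{1..n}\<close> lies outside \<open>dom f\<close>, and a
  permutation must send it to the one value not yet taken.\<close>

lemma permutation_extension_unique:
  assumes f: "f \<in> carrier (sym_inv_monoid n)" and rank: "n - 1 \<le> map_rank f"
    and p: "p \<in> carrier (symmetric_group n)" "f \<subseteq>\<^sub>m p"
    and q: "q \<in> carrier (symmetric_group n)" "f \<subseteq>\<^sub>m q"
  shows "p = q"
proof -
  have perm: "dom h = {1..n} \<and> ran h = {1..n} \<and> inj_on h {1..n}"
    if "h \<in> carrier (symmetric_group n)" for h
  proof -
    have h: "h \<in> carrier (sym_inv_monoid n)" "dom h = {1..n}"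
      using that by (simp_all add: carrier_symmetric_group)
    then have "ran h \<subseteq> {1..n}" and "card (ran h) = n" and "inj_on h {1..n}"
      using map_rank_eq_card_dom[OF h(1)] by (auto simp: sym_inv_monoid_def map_rank_def)
    then show ?thesis
      using h(2) card_subset_eq[of "{1..n}" "ran h"] by simp
  qed
  have dom_f: "dom f \<subseteq> {1..n}"
    using f by (simp add: sym_inv_monoid_def)
  have agree: "p x = q x" if "x \<in> dom f" for x
    using that p(2) q(2) by (metis map_le_def)
  have "card ({1..n} - dom f) \<le> 1"
    using rank dom_f by (simp add: map_rank_eq_card_dom[OF f] card_Diff_subset finite_subset[OF dom_f])
  then have at_most_one: "x = y" if "x \<in> {1..n} - dom f" "y \<in> {1..n} - dom f" for x y
    using that by (metis One_nat_def card_le_Suc0_iff_eq finite_Diff finite_atLeastAtMost)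
  show ?thesis
  proof (rule ext)
    fix x
    consider "x \<notin> {1..n}" | "x \<in> dom f" | "x \<in> {1..n} - dom f"
      by blast
    then show "p x = q x"
    proof cases
      case 1
      then show ?thesis using perm[OF p(1)] perm[OF q(1)] by (metis domIff)
    next
      case 2
      then show ?thesis by (rule agree)
    next
      case 3
      then obtain y where y: "p x = Some y" using perm[OF p(1)] by (metis DiffD1 domD)
      \<comment> \<open>Surjectivity of \<open>q\<close> yields a point \<open>z\<close> with the
        same image. It cannot lie in \<open>dom f\<close>, where \<open>p\<close> and
        \<open>q\<close> agree, since \<open>p\<close> is injective; so \<open>z\<close> is the
        missing point \<open>x\<close>.\<close>
      then have "y \<in> ran q" using perm[OF p(1)] perm[OF q(1)] by (metis ranI)
      then obtain z where z: "q z = Some y" by (auto simp: ran_def)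
      then have zn: "z \<in> {1..n}" using perm[OF q(1)] by (metis domI)
      have "z \<notin> dom f"
      proof
        assume "z \<in> dom f"
        then have "p z = p x" using agree y z by simp
        then have "z = x" using perm[OF p(1)] zn 3 by (metis DiffD1 inj_onD)
        with \<open>z \<in> dom f\<close> 3 show False by simp
      qed
      then have "z = x" using at_most_one zn 3 by simp
      then show ?thesis using y z by simp
    qed
  qed
qed

text \<open>If \<open>x\<close> is sent to \<open>y\<close>, idempotence sends \<open>y\<close> to
  \<open>y\<close>, and injectivity forces \<open>x = y\<close>.\<close>

lemma idempotent_sym_inv_monoid:
  assumes f: "f \<in> carrier (sym_inv_monoid n)"
    and idem: "f \<otimes>\<^bsub>sym_inv_monoid n\<^esub> f = f"
  shows "f = Some |` dom f"
proof (rule ext)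
  fix x show "f x = (Some |` dom f) x"
  proof (cases "f x")
    case None
    then show ?thesis by (simp add: restrict_map_def domIff)
  next
    case (Some y)
    with idem have "f y = Some y"
      by (metis map_comp_simps(2) mult_sym_inv_monoid)
    moreover have "inj_on f (dom f)"
      using f by (simp add: sym_inv_monoid_def)
    ultimately have "x = y"
      using Some by (metis domI inj_onD)
    with Some show ?thesis by (simp add: domI)
  qed
qed

section \<open>The invariant as a congruence, and the contradiction\<close>

text \<open>Invariance of \<pi> is put into a relation, so that minimality of the generated
  congruence replaces an induction over derivations. Pairs of rank below \<open>r\<close> remain
  unconstrained; testing \<open>u\<close> alone suffices, as both words have the same value under
  \<rho>.\<close>

definition rank_bounded_kernel ::
    "'a set \<Rightarrow> nat \<Rightarrow> ('a \<Rightarrow> nat \<rightharpoonup> nat) \<Rightarrow> ('a \<Rightarrow> nat \<rightharpoonup> nat) \<Rightarrow> nat \<Rightarrow> ('a list \<times> 'a list) set" where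
  "rank_bounded_kernel X n \<rho> \<rho>' r =
     {(u, v) \<in> word_kernel X (sym_inv_monoid n) \<rho>.
        r \<le> word_rank n \<rho> u \<longrightarrow>
          word_value (sym_inv_monoid n) \<rho>' u = word_value (sym_inv_monoid n) \<rho>' v}"

text \<open>If a product with \<open>w\<close> has rank at least \<open>r\<close>, so does the
  original word; the equality under \<open>\<rho>'\<close> is then available and survives
  multiplication.\<close>

lemma word_congruence_rank_bounded_kernel:
  assumes \<rho>: "\<rho> \<in> X \<rightarrow> carrier (sym_inv_monoid n)" and \<rho>': "\<rho>' \<in> X \<rightarrow> carrier (sym_inv_monoid n)"
  shows "word_congruence X (rank_bounded_kernel X n \<rho> \<rho>' r)"
proof -
  note append = word_value_append[OF monoid_sym_inv_monoid]
  note closed = word_value_closed[OF monoid_sym_inv_monoid]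
  let ?E = "rank_bounded_kernel X n \<rho> \<rho>' r"
  have "equiv (lists X) ?E"
    by (rule equivI)
       (auto simp: rank_bounded_kernel_def word_kernel_def word_rank_def
         refl_on_def intro!: symI transI)
  moreover have "(w @ u, w @ v) \<in> ?E \<and> (u @ w, v @ w) \<in> ?E"
    if uv: "(u, v) \<in> ?E" and w: "w \<in> lists X" for u v w
  proof -
    have u: "u \<in> lists X" and v: "v \<in> lists X"
      and eq: "word_value (sym_inv_monoid n) \<rho> u = word_value (sym_inv_monoid n) \<rho> v"
      and eq': "r \<le> word_rank n \<rho> u \<Longrightarrow>
        word_value (sym_inv_monoid n) \<rho>' u = word_value (sym_inv_monoid n) \<rho>' v"
      using uv by (simp_all add: rank_bounded_kernel_def word_kernel_def)
    have "word_rank n \<rho> (w @ u) \<le> word_rank n \<rho> u" and "word_rank n \<rho> (u @ w) \<le> word_rank n \<rho> u"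
      by (simp_all add: word_rank_def append[OF \<rho>] map_rank_mult_le closed[OF \<rho>] u w del: in_lists_conv_set)
    then show ?thesis
      using u v w eq eq'
      by (simp add: rank_bounded_kernel_def word_kernel_def append[OF \<rho>] append[OF \<rho>'] del: in_lists_conv_set)
  qed
  ultimately show ?thesis
    unfolding word_congruence_def by auto
qed

theorem lemma4p5:
  fixes n :: nat
    and A :: "'a set" and \<eta> :: 'a
    and R S :: "('a list \<times> 'a list) set"
    and \<rho> :: "'a \<Rightarrow> nat \<rightharpoonup> nat"
  assumes "n \<ge> 4"
    and "\<eta> \<notin> A"
    and "monoid_presentation A R (symmetric_group n) \<rho>"
    and "monoid_presentation (A \<union> {\<eta>}) (R \<union> S) (sym_inv_monoid n) \<rho>"
    and "\<rho> \<eta> \<otimes>\<^bsub>sym_inv_monoid n\<^esub> \<rho> \<eta> = \<rho> \<eta>"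
    and "map_rank (\<rho> \<eta>) = n - 1"
    and "1 \<notin> dom (\<rho> \<eta>)"
  shows "\<exists>r \<in> S. relation_rank n \<rho> r = n - 2"
proof (rule ccontr)
  assume no_relation: "\<not> ?thesis"
  let ?M = "sym_inv_monoid n" and ?X = "A \<union> {\<eta>}"
  \<comment> \<open>Sending \<eta> to the identity has the effect of erasing it, so
    \<open>?perm w\<close> is \<pi>(w).\<close>
  define \<rho>' where "\<rho>' = \<rho>(\<eta> := Some |` {1..n})"
  let ?val = "word_value ?M \<rho>" and ?perm = "word_value ?M \<rho>'"
  let ?E = "rank_bounded_kernel ?X n \<rho> \<rho>' (n - 2)"
  have \<rho>: "\<rho> \<in> ?X \<rightarrow> carrier ?M"
    and kernel: "word_kernel ?X ?M \<rho> = generated_congruence ?X (R \<union> S)"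
    and \<rho>_A: "\<rho> \<in> A \<rightarrow> carrier (symmetric_group n)"
    and R: "R \<subseteq> lists A \<times> lists A"
    and val_A: "?val ` lists A = carrier (symmetric_group n)"
    using assms(3,4) by (auto simp: monoid_presentation_def word_value_symmetric_group)
  have \<rho>\<eta>: "\<rho> \<eta> = Some |` {2..n}"
  proof -
    have \<eta>: "\<rho> \<eta> \<in> carrier ?M" using \<rho> by auto
    then have "dom (\<rho> \<eta>) \<subseteq> {1..n}" by (simp add: sym_inv_monoid_def)
    moreover have "x \<noteq> 1" if "x \<in> dom (\<rho> \<eta>)" for x using that assms(7) by metis
    ultimately have "dom (\<rho> \<eta>) \<subseteq> {2..n}" by fastforce
    moreover have "card (dom (\<rho> \<eta>)) = card {2..n}"
      using assms(6) \<eta> by (simp add: map_rank_eq_card_dom)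
    ultimately have "dom (\<rho> \<eta>) = {2..n}" by (simp add: card_subset_eq)
    then show ?thesis using idempotent_sym_inv_monoid[OF \<eta> assms(5)] by simp
  qed
  have "\<rho>' \<eta> = \<one>\<^bsub>symmetric_group n\<^esub>"
    by (simp add: \<rho>'_def symmetric_group_def units_of_def sym_inv_monoid_def)
  then have \<rho>': "\<rho>' \<in> ?X \<rightarrow> carrier (symmetric_group n)"
    using \<rho>_A monoid.one_closed[OF monoid_symmetric_group]
    by (auto simp: Pi_iff) (auto simp: \<rho>'_def)
  then have \<rho>'_M: "\<rho>' \<in> ?X \<rightarrow> carrier ?M"
    by (auto simp: carrier_symmetric_group)
  have perm: "?perm w \<in> carrier (symmetric_group n)" if "w \<in> lists ?X" for w
    using word_value_closed[OF monoid_symmetric_group \<rho>' that]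
    by (simp add: word_value_symmetric_group)
  have le: "?val w \<subseteq>\<^sub>m ?perm w" for w
    by (rule word_value_sym_inv_monoid_mono) (auto simp: \<rho>'_def \<rho>\<eta> map_le_def)
  have "R \<union> S \<subseteq> ?E"
  proof (rule subrelI)
    fix u v assume uv: "(u, v) \<in> R \<union> S"
    then have ker: "(u, v) \<in> word_kernel ?X ?M \<rho>"
      unfolding kernel by (rule subsetD[OF generated_congruence_superset])
    then have u: "u \<in> lists ?X" and v: "v \<in> lists ?X" and eq: "?val u = ?val v"
      by (simp_all add: word_kernel_def)
    have "?perm u = ?perm v" if "n - 2 \<le> word_rank n \<rho> u"
    proof -
      \<comment> \<open>Relations in \<open>R\<close> have rank \<open>n\<close>, and those in
        \<open>S\<close> avoid \<open>n - 2\<close> by assumption. The rank is therefore at least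
        \<open>n - 1\<close>, where extensions are unique.\<close>
      have "word_rank n \<rho> u \<noteq> n - 2"
      proof (cases "(u, v) \<in> R")
        case True
        then have "u \<in> lists A" using R by blast
        then have "?val u \<in> carrier (symmetric_group n)" using val_A by blast
        then have "word_rank n \<rho> u = n"
          using map_rank_eq_card_dom[of "?val u" n]
          by (simp add: word_rank_def carrier_symmetric_group)
        then show ?thesis using assms(1) by simp
      next
        case False
        then have "(u, v) \<in> S" using uv by blast
        then show ?thesis using no_relation by (force simp: relation_rank_def)
      qed
      then have "n - 1 \<le> map_rank (?val u)" using that by (simp add: word_rank_def)
      then show ?thesis
        using word_value_closed[OF monoid_sym_inv_monoid \<rho> u] le[of v]
        by (intro permutation_extension_unique[of "?val u" n] perm u v le) (simp_all only: eq)
    qed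
    with ker show "(u, v) \<in> ?E" by (simp add: rank_bounded_kernel_def)
  qed
  then have invariant: "word_kernel ?X ?M \<rho> \<subseteq> ?E"
    unfolding kernel
    by (rule generated_congruence_least[OF word_congruence_rank_bounded_kernel[OF \<rho> \<rho>'_M]])

  define \<tau> where "\<tau> = (\<lambda>x. if x \<in> {1..n} then Some (transpose 1 2 x) else None)"
  have "\<tau> \<in> carrier (symmetric_group n)"
    using assms(1)
    by (auto simp: carrier_symmetric_group sym_inv_monoid_def \<tau>_def dom_def ran_def inj_on_def
        transpose_def split: if_splits)
  then obtain t where t: "t \<in> lists A" "?val t = \<tau>"
    unfolding val_A[symmetric] by (elim imageE) simp
  then have t_X: "t \<in> lists ?X" by auto
  have perm_t: "?perm t = \<tau>"
  proof -
    have "x \<in> set t \<Longrightarrow> \<rho>' x = \<rho> x" for x using t(1) assms(2) by (auto simp: \<rho>'_def)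
    then have "?perm t = ?val t" by (induction t) auto
    with t(2) show ?thesis by simp
  qed
  let ?u = "[\<eta>] @ t @ [\<eta>]" and ?v = "[\<eta>] @ t @ [\<eta>] @ t"
  have value_u: "word_value ?M \<sigma> ?u = \<sigma> \<eta> \<circ>\<^sub>m word_value ?M \<sigma> t \<circ>\<^sub>m \<sigma> \<eta>"
    and value_v: "word_value ?M \<sigma> ?v =
      word_value ?M \<sigma> t \<circ>\<^sub>m \<sigma> \<eta> \<circ>\<^sub>m word_value ?M \<sigma> t \<circ>\<^sub>m \<sigma> \<eta>"
    if \<sigma>: "\<sigma> \<in> ?X \<rightarrow> carrier ?M" for \<sigma>
  proof -
    have "\<sigma> \<eta> \<in> carrier ?M" using \<sigma> by auto
    then show "word_value ?M \<sigma> ?u = \<sigma> \<eta> \<circ>\<^sub>m word_value ?M \<sigma> t \<circ>\<^sub>m \<sigma> \<eta>"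
      and "word_value ?M \<sigma> ?v =
        word_value ?M \<sigma> t \<circ>\<^sub>m \<sigma> \<eta> \<circ>\<^sub>m word_value ?M \<sigma> t \<circ>\<^sub>m \<sigma> \<eta>"
      using t_X word_value_append[OF monoid_sym_inv_monoid \<sigma> t_X, of "[\<eta>]"]
        word_value_append[OF monoid_sym_inv_monoid \<sigma> t_X, of "\<eta> # t"]
      by (simp_all add: monoid.r_one[OF monoid_sym_inv_monoid])
         (simp_all add: mult_sym_inv_monoid)
  qed
  \<comment> \<open>The first \<eta> deletes 1; \<tau> moves 2 to 1, where the second \<eta> deletes
    it. The remaining points \<open>{3..n}\<close> are fixed by \<tau>, so a further
    \<open>t\<close> changes nothing.\<close>
  have val: "?val ?u = Some |` {3..n}" "?val ?v = Some |` {3..n}"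
    unfolding value_u[OF \<rho>] value_v[OF \<rho>] t(2) \<rho>\<eta>
    by (auto simp: \<tau>_def transpose_def fun_eq_iff map_comp_def restrict_map_def)
  then have "(?u, ?v) \<in> word_kernel ?X ?M \<rho>"
    using t_X by (simp add: word_kernel_def)
  moreover have "n - 2 \<le> word_rank n \<rho> ?u"
  proof -
    have "?u \<in> lists ?X" using t_X by simp
    then have "?val ?u \<in> carrier ?M"
      by (rule word_value_closed[OF monoid_sym_inv_monoid \<rho>])
    then have "word_rank n \<rho> ?u = card (dom (?val ?u))"
      unfolding word_rank_def by (rule map_rank_eq_card_dom)
    then show ?thesis unfolding val by simp
  qed
  ultimately have "?perm ?u = ?perm ?v"
    using subsetD[OF invariant] unfolding rank_bounded_kernel_def by blast
  \<comment> \<open>With \<eta> erased, the two words represent \<tau> and its square, the identity;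
    the point 1 separates them.\<close>
  moreover have "?perm ?u 1 = Some 2" "?perm ?v 1 = Some 1"
    unfolding value_u[OF \<rho>'_M] value_v[OF \<rho>'_M] perm_t
    using assms(1) by (simp_all add: \<rho>'_def \<tau>_def map_comp_def)
  ultimately show False by simp
qed

end
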